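(* Let $T$ be a locally finite tree with a fixed root at infinity, in which every vertex has at least two successors, and let $m$ be a flow measure on $T$ with $C_m:=\sup_{x\in T}\frac{m(p(x))}{m(x)}<\infty$. Assume that there exists a constant $k_c>1$ such that $\sigma_c(n)=k_c^n$ for all $n\in\mathbb Z$. Then the Bergman kernel $K_c$ of $L^2(m\cdot\sigma_c)$ satisfies $$|K_c(x,z)|\approx\frac{1}{\sigma_c(x\wedge z)\,m(x\wedge z)}\qquad\forall x,z\in T,$$ i.e. there is a constant $C>0$, independent of $x$ and $z$, such that each side is at most $C$ times the other.
   Context: Tree notation. $T$ is an infinite locally finite tree with graph distance $d$ and a fixed reference vertex $o$. The boundary $\partial T$ is the set of equivalence classes of infinite geodesics starting at $o$ (two being equivalent if they eventually coincide). Fix $\omega\in\partial T$ (the root at infinity); let $[o,\omega)=\{x_n\}_{n\ge0}$ be the geodesic ray from $o$ (with $x_0=o$) representing $\omega$. The level is $\ell(x)=\lim_{n\to\infty}(n-d(x,x_n))$. For each vertex $x$, $p(x)$ is the unique neighbour with $\ell(p(x))=\ell(x)+1$, and $s(x)$ is the set of the other neighbours (successors). $p^0(x)=x$, $p^n(x)=p(p^{n-1}(x))$; $s_0(x)=\{x\}$, $s_n(x)=\bigcup_{y\in s_{n-1}(x)}s(y)$. $T_x=\bigcup_{n\ge0}s_n(x)$ and $\dot T_x=T_x\setminus\{x\}$. A vertex $y$ lies above $x$ if $y=p^n(x)$ for some $n\ge0$; the confluent $x\wedge y$ is the vertex of minimum level lying above both $x$ and $y$. A flow measure is a function $m:T\to(0,\infty)$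 with $m(x)=\sum_{y\in s(x)}m(y)$ for all $x$. The function $\sigma_c$ on $\mathbb Z$ is also viewed as a function on $T$ via $\sigma_c(x)=\sigma_c(\ell(x))$, and $m\cdot\sigma_c$ is the measure on $T$ giving mass $m(x)\sigma_c(x)$ to the vertex $x$. For $n\in\mathbb Z$, $x\in T$, set $S_{n,x}(\sigma_c)=\sum_{k=0}^\infty\sigma_c(\ell(x)+n-k)$. For $v,z,x\in T$ set $\Psi(v,z,x)=0$ if $\{x,z\}\not\subset\dot T_v$; $\Psi(v,z,x)=\frac1{m(y)}-\frac1{m(v)}$ if $\{x,z\}\subset T_y$ for some $y\in s(v)$; and $\Psi(v,z,x)=-\frac1{m(v)}$ otherwise. The Bergman kernel of $L^2(m\cdot\sigma_c)$ is $$K_c(x,y)=\sum_{n=0}^\infty\frac{\Psi(p^{n+1}(x),p^n(x),y)}{S_{n,x}(\sigma_c)},\qquad x,y\in T;$$ it is the reproducing kernel of the space of functions $f\in L^2(m\cdot\sigma_c)$ that are harmonic, i.e. satisfy $f(x)=\sum_{y\in s(x)}f(y)\frac{m(y)}{m(x)}$ for all $x\in T$. *)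

theory Defs
  imports Complex_Main
begin

text \<open>
  A simple graph is given by a vertex set \<open>V\<close> and a symmetric, irreflexive edge relation
  \<open>E\<close> on \<open>V\<close>, so that \<open>E `` {x}\<close> is the set of neighbours of \<open>x\<close> and \<open>(x, y) \<in> E ^^ n\<close>
  says that there is a walk of length \<open>n\<close> from \<open>x\<close> to \<open>y\<close>.
\<close>

definition simple_graph :: "'v set \<Rightarrow> 'v rel \<Rightarrow> bool" where
  "simple_graph V E \<longleftrightarrow> E \<subseteq> V \<times> V \<and> sym E \<and> irrefl E"

definition cycle :: "'v rel \<Rightarrow> 'v list \<Rightarrow> bool" where
  "cycle E xs \<longleftrightarrow> 3 \<le> length xs \<and> distinct xs \<and>
     successively (\<lambda>x y. (x, y) \<in> E) xs \<and> (last xs, hd xs) \<in> E"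

definition is_tree :: "'v set \<Rightarrow> 'v rel \<Rightarrow> bool" where
  "is_tree V E \<longleftrightarrow> simple_graph V E \<and> V \<noteq> {} \<and>
     (\<forall>x\<in>V. \<forall>y\<in>V. (x, y) \<in> E\<^sup>*) \<and> (\<nexists>xs. cycle E xs)"

definition locally_finite :: "'v set \<Rightarrow> 'v rel \<Rightarrow> bool" where
  "locally_finite V E \<longleftrightarrow> (\<forall>x\<in>V. finite (E `` {x}))"

definition gdist :: "'v rel \<Rightarrow> 'v \<Rightarrow> 'v \<Rightarrow> nat" where
  "gdist E x y = (LEAST n. (x, y) \<in> E ^^ n)"


subsection \<open>The boundary and the level function\<close>

definition geodesic_rays :: "'v set \<Rightarrow> 'v rel \<Rightarrow> 'v \<Rightarrow> (nat \<Rightarrow> 'v) set" where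
  "geodesic_rays V E v0 = {\<gamma>. \<gamma> 0 = v0 \<and> (\<forall>n. \<gamma> n \<in> V) \<and>
     (\<forall>n. (\<gamma> n, \<gamma> (Suc n)) \<in> E) \<and> (\<forall>i j. i \<le> j \<longrightarrow> gdist E (\<gamma> i) (\<gamma> j) = j - i)}"

text \<open>
  Two rays in \<open>geodesic_rays V E v0\<close> have the same starting point, and the index of a vertex
  on such a ray is its distance from \<open>v0\<close>; hence no shift of the parametrisation is needed
  for eventual coincidence.
\<close>

definition ray_equiv :: "'v set \<Rightarrow> 'v rel \<Rightarrow> 'v \<Rightarrow> (nat \<Rightarrow> 'v) rel" where
  "ray_equiv V E v0 = {(\<gamma>, \<gamma>'). \<gamma> \<in> geodesic_rays V E v0 \<and> \<gamma>' \<in> geodesic_rays V E v0 \<and>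
     (\<forall>\<^sub>F n in sequentially. \<gamma> n = \<gamma>' n)}"

definition boundary :: "'v set \<Rightarrow> 'v rel \<Rightarrow> 'v \<Rightarrow> (nat \<Rightarrow> 'v) set set" where
  "boundary V E v0 = geodesic_rays V E v0 // ray_equiv V E v0"

text \<open>
  All members of a boundary point \<open>\<omega> \<in> boundary V E v0\<close> start at \<open>v0\<close>, and in a tree there is
  exactly one of them; it is the ray \<open>[v0, \<omega>)\<close>. The reference vertex is therefore encoded
  in \<open>\<omega>\<close> and is not a separate argument below.
\<close>

definition ray_to :: "(nat \<Rightarrow> 'v) set \<Rightarrow> nat \<Rightarrow> 'v" where
  "ray_to \<omega> = (THE \<gamma>. \<gamma> \<in> \<omega>)"

definition level :: "'v rel \<Rightarrow> (nat \<Rightarrow> 'v) set \<Rightarrow> 'v \<Rightarrow> int" where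
  "level E \<omega> x = lim (\<lambda>n. int n - int (gdist E x (ray_to \<omega> n)))"


subsection \<open>Predecessors, successors, sectors and confluents\<close>

definition parent :: "'v rel \<Rightarrow> (nat \<Rightarrow> 'v) set \<Rightarrow> 'v \<Rightarrow> 'v" where
  "parent E \<omega> x = (THE y. (x, y) \<in> E \<and> level E \<omega> y = level E \<omega> x + 1)"

definition succs :: "'v rel \<Rightarrow> (nat \<Rightarrow> 'v) set \<Rightarrow> 'v \<Rightarrow> 'v set" where
  "succs E \<omega> x = E `` {x} - {parent E \<omega> x}"

primrec nth_succs :: "'v rel \<Rightarrow> (nat \<Rightarrow> 'v) set \<Rightarrow> nat \<Rightarrow> 'v \<Rightarrow> 'v set" where
  "nth_succs E \<omega> 0 x = {x}"
| "nth_succs E \<omega> (Suc n) x = (\<Union>y\<in>nth_succs E \<omega> n x. succs E \<omega> y)"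

definition sector :: "'v rel \<Rightarrow> (nat \<Rightarrow> 'v) set \<Rightarrow> 'v \<Rightarrow> 'v set" where
  "sector E \<omega> x = (\<Union>n. nth_succs E \<omega> n x)"

definition punctured_sector :: "'v rel \<Rightarrow> (nat \<Rightarrow> 'v) set \<Rightarrow> 'v \<Rightarrow> 'v set" where
  "punctured_sector E \<omega> x = sector E \<omega> x - {x}"

definition lies_above :: "'v rel \<Rightarrow> (nat \<Rightarrow> 'v) set \<Rightarrow> 'v \<Rightarrow> 'v \<Rightarrow> bool" where
  "lies_above E \<omega> y x \<longleftrightarrow> (\<exists>n. y = (parent E \<omega> ^^ n) x)"

definition confluent :: "'v rel \<Rightarrow> (nat \<Rightarrow> 'v) set \<Rightarrow> 'v \<Rightarrow> 'v \<Rightarrow> 'v" where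
  "confluent E \<omega> x y =
     (THE v. is_arg_min (level E \<omega>) (\<lambda>u. lies_above E \<omega> u x \<and> lies_above E \<omega> u y) v)"


subsection \<open>Flow measures and the Bergman kernel\<close>

definition flow_measure ::
    "'v set \<Rightarrow> 'v rel \<Rightarrow> (nat \<Rightarrow> 'v) set \<Rightarrow> ('v \<Rightarrow> real) \<Rightarrow> bool" where
  "flow_measure V E \<omega> m \<longleftrightarrow>
     (\<forall>x\<in>V. 0 < m x \<and> m x = (\<Sum>y\<in>succs E \<omega> x. m y))"

definition S_sum ::
    "'v rel \<Rightarrow> (nat \<Rightarrow> 'v) set \<Rightarrow> (int \<Rightarrow> real) \<Rightarrow> int \<Rightarrow> 'v \<Rightarrow> real" where
  "S_sum E \<omega> \<sigma> n x = (\<Sum>k. \<sigma> (level E \<omega> x + n - int k))"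

text \<open>The sectors below distinct successors of \<open>v\<close> are disjoint, so \<open>THE\<close> below is justified.\<close>

definition Psi ::
    "'v rel \<Rightarrow> (nat \<Rightarrow> 'v) set \<Rightarrow> ('v \<Rightarrow> real) \<Rightarrow> 'v \<Rightarrow> 'v \<Rightarrow> 'v \<Rightarrow> real" where
  "Psi E \<omega> m v z x =
     (if \<not> {x, z} \<subseteq> punctured_sector E \<omega> v then 0
      else if \<exists>y\<in>succs E \<omega> v. {x, z} \<subseteq> sector E \<omega> y
      then 1 / m (THE y. y \<in> succs E \<omega> v \<and> {x, z} \<subseteq> sector E \<omega> y) - 1 / m v
      else - 1 / m v)"

definition bergman_kernel ::
    "'v rel \<Rightarrow> (nat \<Rightarrow> 'v) set \<Rightarrow> ('v \<Rightarrow> real) \<Rightarrow> (int \<Rightarrow> real) \<Rightarrow> 'v \<Rightarrow> 'v \<Rightarrow> real" where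
  "bergman_kernel E \<omega> m \<sigma> x y =
     (\<Sum>n. Psi E \<omega> m ((parent E \<omega> ^^ (n + 1)) x) ((parent E \<omega> ^^ n) x) y
           / S_sum E \<omega> \<sigma> (int n) x)"

end

theory Submission
  imports Defs
begin

text \<open>
  Let \<open>w = x \<and> z\<close> be the confluent, say \<open>w = p\<^sup>j(x)\<close>, and put \<open>a\<^sub>n = 1 / m(p\<^sup>n(x))\<close>. Below \<open>w\<close> the
  ancestors of \<open>x\<close> do not see \<open>z\<close>, so the terms of the kernel series with \<open>n + 1 < j\<close> vanish. From
  \<open>n = j\<close> on, \<open>x\<close> and \<open>z\<close> lie below the same child and \<open>\<Psi>\<close> is \<open>a\<^sub>n - a\<^sub>n\<^sub>+\<^sub>1\<close>. The term \<open>n + 1 = j\<close>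
  is the only negative one; it occurs exactly when \<open>w\<close> is neither \<open>x\<close> nor \<open>z\<close>, and then \<open>\<Psi>\<close> is
  \<open>-a\<^sub>j\<close>. For \<open>\<sigma>\<^sub>c(n) = k\<^sup>n\<close> the weights \<open>S\<close> form a geometric series, and so
  (\<open>bergman_kernel_eq\<close>)
  \<open>K\<^sub>c(x, z) = (1 - 1/k) k\<^sup>-\<^sup>l (s - \<delta>)\<close>, where \<open>l\<close> is the level of \<open>w\<close>,
  \<open>s = \<Sum>\<^sub>i k\<^sup>-\<^sup>i (a\<^sub>j\<^sub>+\<^sub>i - a\<^sub>j\<^sub>+\<^sub>i\<^sub>+\<^sub>1)\<close>, and \<open>\<delta>\<close> is \<open>k a\<^sub>j\<close> or \<open>0\<close>.

  Replacing the factors \<open>k\<^sup>-\<^sup>i\<close> by \<open>1\<close> makes the sum telescope, so \<open>s \<le> a\<^sub>j\<close>; the first term alone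
  gives \<open>s \<ge> a\<^sub>j - a\<^sub>j\<^sub>+\<^sub>1\<close> (\<open>damped_telescoping_sum\<close>). A vertex has a sibling, whose mass is at least
  \<open>1/C\<close> times that of their parent, so \<open>a\<^sub>j - a\<^sub>j\<^sub>+\<^sub>1 \<ge> a\<^sub>j / C\<close> (\<open>inverse_mass_drop\<close>). If \<open>\<delta> = 0\<close>,
  then \<open>s - \<delta>\<close> lies between \<open>a\<^sub>j / C\<close> and \<open>a\<^sub>j\<close>. Otherwise \<open>\<delta> - s\<close> lies between
  \<open>(k - 1) a\<^sub>j\<close> and \<open>k a\<^sub>j\<close>: since \<open>k > 1\<close>, the positive tail cannot cancel the negative term.

  The rest translates the graph-theoretic definitions into statements about the parent map.
  In a tree, a neighbour of \<open>x\<close> is either one closer to or one farther from a given vertex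
  \<open>r \<noteq> x\<close>, and exactly one neighbour is closer, because every edge is a bridge. Letting \<open>r\<close> run
  along the ray to \<open>\<omega>\<close>, this shows that each vertex has exactly one neighbour of higher level, that
  the successors are the vertices with a given parent, and that any two vertices have a common
  ancestor, as all ancestor chains eventually join the ray.
\<close>

section \<open>Distances in a tree\<close>

text \<open>
  A chain in \<open>R\<close> that returns to a vertex already visited can be cut short there. This links
  reachability to cycles, which are given by lists of distinct vertices.
\<close>
lemma rtrancl_simple_path:
  assumes "(x, y) \<in> R\<^sup>*"
  shows "\<exists>xs. xs \<noteq> [] \<and> hd xs = x \<and> last xs = y \<and> distinct xs
           \<and> successively (\<lambda>u v. (u, v) \<in> R) xs"
  using assms
proof (induction rule: converse_rtrancl_induct)
  case base
  show ?case by (intro exI[of _ "[y]"]) simp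
next
  case (step x x')
  then obtain xs where xs: "xs \<noteq> []" "hd xs = x'" "last xs = y" "distinct xs"
    "successively (\<lambda>u v. (u, v) \<in> R) xs" by blast
  show ?case
  proof (cases "x \<in> set xs")
    case True
    then obtain ys zs where "xs = ys @ x # zs" by (meson split_list)
    with xs show ?thesis
      by (intro exI[of _ "x # zs"]) (auto simp: successively_append_iff)
  next
    case False
    with xs step(1) show ?thesis
      by (intro exI[of _ "x # xs"]) (auto simp: successively_Cons)
  qed
qed

lemma relpow_sym: "sym R \<Longrightarrow> (x, y) \<in> R ^^ n \<Longrightarrow> (y, x) \<in> R ^^ n"
proof (induction n arbitrary: y)
  case (Suc n)
  then obtain z where "(x, z) \<in> R ^^ n" "(z, y) \<in> R" by auto
  with Suc show ?case by (meson relpow_Suc_I2 symD)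
qed auto

locale tree_graph =
  fixes V :: "'v set" and E :: "'v rel"
  assumes is_tree: "is_tree V E"
begin

lemma edge_in_V: "(x, y) \<in> E \<Longrightarrow> x \<in> V \<and> y \<in> V"
  and edge_sym: "(x, y) \<in> E \<Longrightarrow> (y, x) \<in> E"
  and edge_irrefl: "(x, x) \<notin> E"
  and sym_E: "sym E"
  using is_tree unfolding is_tree_def simple_graph_def by (auto simp: sym_def irrefl_def)

lemma gdist_walk:
  assumes "x \<in> V" "y \<in> V"
  shows "(x, y) \<in> E ^^ gdist E x y"
proof -
  have "(x, y) \<in> E\<^sup>*" using is_tree assms unfolding is_tree_def by blast
  then show ?thesis unfolding gdist_def by (metis LeastI rtrancl_imp_relpow)
qed

lemma gdist_le: "(x, y) \<in> E ^^ n \<Longrightarrow> gdist E x y \<le> n"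
  unfolding gdist_def by (rule Least_le)

lemma gdist_self [simp]: "gdist E x x = 0"
  using gdist_le[of x x 0] by simp

lemma gdist_eq_0: "x \<in> V \<Longrightarrow> y \<in> V \<Longrightarrow> gdist E x y = 0 \<Longrightarrow> x = y"
  using gdist_walk[of x y] by simp

lemma gdist_commute: "gdist E x y = gdist E y x"
proof -
  have "(x, y) \<in> E ^^ n \<longleftrightarrow> (y, x) \<in> E ^^ n" for n
    using relpow_sym[OF sym_E] by blast
  then show ?thesis unfolding gdist_def by simp
qed

lemma gdist_edge_le: "(x, y) \<in> E \<Longrightarrow> r \<in> V \<Longrightarrow> gdist E x r \<le> Suc (gdist E y r)"
  using gdist_walk[of y r] by (meson edge_in_V gdist_le relpow_Suc_I2)

lemma gdist_triangle:
  "x \<in> V \<Longrightarrow> y \<in> V \<Longrightarrow> z \<in> V \<Longrightarrow> gdist E x z \<le> gdist E x y + gdist E y z"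
  by (meson gdist_le gdist_walk relpow_trans)

lemma closer_neighbour_exists:
  assumes "x \<in> V" "r \<in> V" "x \<noteq> r"
  obtains y where "(x, y) \<in> E" "gdist E x r = Suc (gdist E y r)"
proof -
  obtain n where n: "gdist E x r = Suc n"
    using assms gdist_eq_0 not0_implies_Suc by blast
  then have "(x, r) \<in> E ^^ Suc n" using gdist_walk assms by metis
  then obtain y where y: "(x, y) \<in> E" "(y, r) \<in> E ^^ n" by (rule relpow_Suc_E2)
  with n gdist_edge_le[OF y(1) assms(2)] gdist_le[OF y(2)] that show ?thesis by force
qed

text \<open>A simple path that joins the ends of an edge without using it closes up to a cycle.\<close>
lemma edge_is_bridge:
  assumes "(x, y) \<in> E"
  shows "(x, y) \<notin> (E - {(x, y), (y, x)})\<^sup>*"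
proof
  assume "(x, y) \<in> (E - {(x, y), (y, x)})\<^sup>*"
  then obtain xs where xs: "xs \<noteq> []" "hd xs = x" "last xs = y" "distinct xs"
    "successively (\<lambda>u v. (u, v) \<in> E - {(x, y), (y, x)}) xs"
    by (auto dest!: rtrancl_simple_path)
  have "x \<noteq> y" using assms edge_irrefl by blast
  have "3 \<le> length xs"
  proof (rule ccontr)
    assume "\<not> 3 \<le> length xs"
    then have "length xs = 0 \<or> length xs = 1 \<or> length xs = 2" by linarith
    with xs \<open>x \<noteq> y\<close> show False
      by (auto simp: length_Suc_conv numeral_2_eq_2)
  qed
  moreover have "successively (\<lambda>u v. (u, v) \<in> E) xs"
    by (rule successively_mono[OF xs(5)]) auto
  ultimately have "cycle E xs"
    unfolding cycle_def using xs edge_sym[OF assms] by simp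
  then show False using is_tree unfolding is_tree_def by blast
qed

text \<open>
  Distances to \<open>r\<close> strictly decrease along a geodesic to \<open>r\<close>. One starting at \<open>a \<noteq> v\<close> no farther from
  \<open>r\<close> than \<open>v\<close> therefore misses \<open>v\<close>, and with it every edge at \<open>v\<close>. Together with
  \<open>edge_is_bridge\<close> this governs how the distance to \<open>r\<close> varies across an edge.
\<close>
lemma geodesic_avoids_edge:
  assumes "r \<in> V" "a \<in> V" "a \<noteq> v" "gdist E a r \<le> gdist E v r"
  shows "(a, r) \<in> (E - {(u, v), (v, u)})\<^sup>*"
  using assms(2-4)
proof (induction "gdist E a r" arbitrary: a rule: less_induct)
  case less
  show ?case
  proof (cases "a = r")
    case False
    then obtain b where b: "(a, b) \<in> E" "gdist E a r = Suc (gdist E b r)"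
      using closer_neighbour_exists less.prems assms(1) by metis
    then have "b \<noteq> v" using less.prems by auto
    then have "(b, r) \<in> (E - {(u, v), (v, u)})\<^sup>*"
      using less.hyps[of b] b less.prems edge_in_V by force
    moreover have "(a, b) \<in> E - {(u, v), (v, u)}"
      using b \<open>b \<noteq> v\<close> less.prems by auto
    ultimately show ?thesis by (rule converse_rtrancl_into_rtrancl[rotated])
  qed simp
qed

lemma rtrancl_minus_edge_sym:
  assumes "(a, b) \<in> (E - {(u, v), (v, u)})\<^sup>*"
  shows "(b, a) \<in> (E - {(u, v), (v, u)})\<^sup>*"
proof -
  have "sym (E - {(u, v), (v, u)})" using sym_E by (auto simp: sym_def)
  then show ?thesis using assms sym_rtrancl symD by metis
qed

text \<open>
  If the ends of an edge were equidistant from \<open>r\<close>, geodesics through \<open>r\<close> would bypass the edge.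
\<close>
lemma gdist_edge_neq:
  assumes xy: "(x, y) \<in> E" and r: "r \<in> V"
  shows "gdist E x r \<noteq> gdist E y r"
proof
  assume eq: "gdist E x r = gdist E y r"
  have ne: "x \<noteq> y" and V: "x \<in> V" "y \<in> V" using xy edge_irrefl edge_in_V by auto
  have "(x, r) \<in> (E - {(x, y), (y, x)})\<^sup>*"
    using geodesic_avoids_edge[of r x y x] r V ne eq by simp
  moreover have "(r, y) \<in> (E - {(x, y), (y, x)})\<^sup>*"
    using geodesic_avoids_edge[of r y x y] r V ne eq rtrancl_minus_edge_sym
    by (simp add: insert_commute)
  ultimately show False using edge_is_bridge[OF xy] by (meson rtrancl_trans)
qed

text \<open>
  If two neighbours of \<open>x\<close> were closer to \<open>r\<close>, one could go from \<open>x\<close> to the second, on to \<open>r\<close> and back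
  to the first, bypassing the edge to the first.
\<close>
lemma closer_neighbour_unique:
  assumes y1: "(x, y1) \<in> E" "gdist E y1 r < gdist E x r"
    and y2: "(x, y2) \<in> E" "gdist E y2 r < gdist E x r" and r: "r \<in> V"
  shows "y1 = y2"
proof (rule ccontr)
  assume ne: "y1 \<noteq> y2"
  let ?E = "E - {(x, y1), (y1, x)}"
  have V: "y1 \<in> V" "y2 \<in> V" and x: "x \<noteq> y1" "x \<noteq> y2"
    using y1 y2 edge_in_V by auto
  have "(y1, r) \<in> ?E\<^sup>*" "(y2, r) \<in> ?E\<^sup>*"
    using geodesic_avoids_edge[of r y1 x y1] geodesic_avoids_edge[of r y2 x y1] r V x y1 y2
    by (simp_all add: insert_commute)
  moreover have "(x, y2) \<in> ?E" using y2(1) ne x by auto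
  ultimately have "(x, y1) \<in> ?E\<^sup>*"
    by (meson converse_rtrancl_into_rtrancl rtrancl_minus_edge_sym rtrancl_trans)
  then show False using edge_is_bridge[OF y1(1)] by blast
qed

end


section \<open>The parent map determined by a boundary point\<close>

locale tree_end = tree_graph V E for V :: "'v set" and E :: "'v rel" +
  fixes v0 :: 'v and \<omega> :: "(nat \<Rightarrow> 'v) set"
  assumes v0_in_V: "v0 \<in> V" and boundary_point: "\<omega> \<in> boundary V E v0"
begin

abbreviation par :: "'v \<Rightarrow> 'v" where "par \<equiv> parent E \<omega>"
abbreviation lev :: "'v \<Rightarrow> int" where "lev \<equiv> level E \<omega>"
abbreviation ray :: "nat \<Rightarrow> 'v" where "ray \<equiv> ray_to \<omega>"

text \<open>
  Walking back towards \<open>v0\<close>, each vertex of a ray is the unique closer neighbour of the next one.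
  So eventually equal rays are equal, and a boundary point contains a single ray.
\<close>
lemma geodesic_rays_coincide:
  assumes "\<gamma> \<in> geodesic_rays V E v0" "\<gamma>' \<in> geodesic_rays V E v0" "\<gamma> N = \<gamma>' N" "n \<le> N"
  shows "\<gamma> n = \<gamma>' n"
  using assms(4)
proof (induction rule: inc_induct)
  case base
  show ?case by (rule assms(3))
next
  case (step n)
  have dist: "gdist E (\<delta> i) v0 = i" if "\<delta> \<in> geodesic_rays V E v0" for \<delta> i
    using that gdist_commute[of "\<delta> i" v0] unfolding geodesic_rays_def by fastforce
  have edge: "(\<delta> (Suc n), \<delta> n) \<in> E" if "\<delta> \<in> geodesic_rays V E v0" for \<delta>
    using that edge_sym unfolding geodesic_rays_def by blast
  show ?case
    using closer_neighbour_unique[of "\<gamma> (Suc n)" "\<gamma> n" v0 "\<gamma>' n"]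
      edge[OF assms(1)] edge[OF assms(2)] dist[OF assms(1)] dist[OF assms(2)] step.IH v0_in_V
    by simp
qed

lemma ray_geodesic: "ray \<in> geodesic_rays V E v0"
proof -
  obtain \<gamma> where \<gamma>: "\<gamma> \<in> geodesic_rays V E v0" "\<omega> = ray_equiv V E v0 `` {\<gamma>}"
    using boundary_point unfolding boundary_def by (auto elim!: quotientE)
  have "\<delta> = \<gamma>" if \<delta>: "\<delta> \<in> \<omega>" for \<delta>
  proof
    fix n
    have d: "\<delta> \<in> geodesic_rays V E v0" "\<forall>\<^sub>F n in sequentially. \<gamma> n = \<delta> n"
      using \<delta> \<gamma>(2) unfolding ray_equiv_def by auto
    then obtain N where N: "\<And>n. n \<ge> N \<Longrightarrow> \<gamma> n = \<delta> n"
      unfolding eventually_sequentially by blast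
    show "\<delta> n = \<gamma> n"
      using geodesic_rays_coincide[OF d(1) \<gamma>(1), of "max n N" n] N by simp
  qed
  moreover have "\<gamma> \<in> \<omega>" using \<gamma> unfolding ray_equiv_def by simp
  ultimately have "ray = \<gamma>" unfolding ray_to_def by blast
  with \<gamma>(1) show ?thesis by simp
qed

lemma ray_in_V [simp]: "ray n \<in> V"
  and ray_edge: "(ray n, ray (Suc n)) \<in> E"
  and ray_gdist: "i \<le> j \<Longrightarrow> gdist E (ray i) (ray j) = j - i"
  using ray_geodesic unfolding geodesic_rays_def by auto

text \<open>
  The sequence whose limit defines the level (an approximation of the Busemann function). It is
  nondecreasing, bounded and integer-valued, hence eventually equal to the level.
\<close>
definition height :: "nat \<Rightarrow> 'v \<Rightarrow> int" where
  "height n x = int n - int (gdist E x (ray n))"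

lemma height_mono:
  assumes "x \<in> V" "i \<le> j" shows "height i x \<le> height j x"
  using gdist_triangle[of x "ray i" "ray j"] ray_gdist[OF assms(2)] assms
  unfolding height_def by simp

lemma height_le: 
  assumes "x \<in> V" shows "height n x \<le> int (gdist E (ray 0) x)"
  using gdist_triangle[of "ray 0" x "ray n"] ray_gdist[of 0 n] assms
  unfolding height_def by simp

lemma height_edge:
  assumes "(x, y) \<in> E"
  shows "height n y = height n x + 1 \<or> height n y = height n x - 1"
  using gdist_edge_le[OF assms, of "ray n"] gdist_edge_le[OF edge_sym[OF assms], of "ray n"]
    gdist_edge_neq[OF assms, of "ray n"]
  unfolding height_def by simp linarith

lemma height_eventually_level:
  assumes "x \<in> V"
  shows "\<exists>N. \<forall>n\<ge>N. height n x = lev x"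
proof -
  \<comment> \<open>The gap to the upper bound \<open>d(ray 0, x)\<close> is a natural number, so it attains its minimum.\<close>
  define f where "f n = nat (int (gdist E (ray 0) x) - height n x)" for n
  define N where "N = (ARG_MIN f n. True)"
  have min: "f N \<le> f n" for n
    unfolding N_def by (rule arg_min_nat_le) simp
  have stable: "height n x = height N x" if "n \<ge> N" for n
  proof (rule antisym)
    show "height n x \<le> height N x"
      using min[of n] height_le[OF assms, of n] unfolding f_def by (simp add: nat_le_eq_zle)
    show "height N x \<le> height n x" by (rule height_mono[OF assms that])
  qed
  have "(\<lambda>n. height n x) \<longlonglongrightarrow> height N x"
    by (intro tendsto_eventually eventually_sequentiallyI) (rule stable)
  then have "lev x = height N x"
    unfolding level_def height_def by (rule limI)
  then show ?thesis by (intro exI[of _ N] allI impI) (erule ssubst, rule stable)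
qed

lemma height_le_level:
  assumes "x \<in> V" shows "height n x \<le> lev x"
proof -
  obtain N where "\<forall>n\<ge>N. height n x = lev x" using height_eventually_level assms by blast
  then show ?thesis using height_mono[OF assms, of n "max n N"] by simp
qed

text \<open>
  One vertex of the ray far enough out computes the levels of finitely many vertices at once, so
  comparing their levels amounts to comparing their distances to it.
\<close>
lemma levels_attained_together:
  assumes "finite A" "A \<subseteq> V"
  obtains N where "\<And>n x. n \<ge> N \<Longrightarrow> x \<in> A \<Longrightarrow> height n x = lev x"
proof -
  have "\<forall>\<^sub>F n in sequentially. \<forall>x\<in>A. height n x = lev x"
    using assms height_eventually_level unfolding eventually_sequentially[symmetric]
    by (intro eventually_ball_finite) auto
  then show ?thesis using that unfolding eventually_sequentially by blast
qed

lemma level_edge: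
  assumes "(x, y) \<in> E"
  shows "lev y = lev x + 1 \<or> lev y = lev x - 1"
proof -
  obtain N where "\<And>n u. n \<ge> N \<Longrightarrow> u \<in> {x, y} \<Longrightarrow> height n u = lev u"
    using levels_attained_together[of "{x, y}"] assms edge_in_V by auto
  then show ?thesis using height_edge[OF assms, of N] by simp
qed

lemma parent_unique:
  assumes "(x, y) \<in> E" "lev y = lev x + 1"
  shows "par x = y"
  unfolding parent_def
proof (rule the_equality)
  fix y' assume y': "(x, y') \<in> E \<and> lev y' = lev x + 1"
  obtain N where N: "\<And>n u. n \<ge> N \<Longrightarrow> u \<in> {x, y, y'} \<Longrightarrow> height n u = lev u"
    using levels_attained_together[of "{x, y, y'}"] assms y' edge_in_V by auto
  show "y' = y"
    using closer_neighbour_unique[of x y' "ray N" y] assms y' N[of N x] N[of N y] N[of N y']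
    unfolding height_def by force
qed (use assms in simp)

text \<open>
  Once \<open>height n x\<close> has stabilised, the parent is the next vertex on the way to \<open>ray n\<close>: the height
  goes up by one, and as the level can change only by one, the height of the parent has stabilised
  at the same \<open>n\<close>. Hence the argument can be repeated until \<open>ray n\<close> is reached.
\<close>
lemma parent_towards_ray:
  assumes "x \<in> V" "height n x = lev x" "x \<noteq> ray n"
  shows "(x, par x) \<in> E" "lev (par x) = lev x + 1" "height n (par x) = lev (par x)"
    "gdist E x (ray n) = Suc (gdist E (par x) (ray n))"
proof -
  obtain y where y: "(x, y) \<in> E" "gdist E x (ray n) = Suc (gdist E y (ray n))"
    using closer_neighbour_exists assms ray_in_V by metis
  then have h: "height n y = lev x + 1" using assms(2) unfolding height_def by simp
  then have "lev y = lev x + 1"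
    using height_le_level[of y n] level_edge[OF y(1)] y(1) edge_in_V by fastforce
  then show "(x, par x) \<in> E" "lev (par x) = lev x + 1" "height n (par x) = lev (par x)"
    "gdist E x (ray n) = Suc (gdist E (par x) (ray n))"
    using parent_unique y h by auto
qed

lemma parent_edge: "x \<in> V \<Longrightarrow> (x, par x) \<in> E"
  and level_parent: "x \<in> V \<Longrightarrow> lev (par x) = lev x + 1"
proof -
  assume x: "x \<in> V"
  obtain N where N: "\<forall>n\<ge>N. height n x = lev x" using height_eventually_level x by blast
  \<comment> \<open>If \<open>x\<close> itself is \<open>ray N\<close>, move on to the next vertex of the ray.\<close>
  have "ray N \<noteq> ray (Suc N)" using ray_edge edge_irrefl by metis
  then obtain n where "n \<ge> N" "x \<noteq> ray n" by (metis le_Suc_eq order_refl)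
  then show "(x, par x) \<in> E" "lev (par x) = lev x + 1"
    using parent_towards_ray x N by blast+
qed

lemma parent_in_V: "x \<in> V \<Longrightarrow> par x \<in> V"
  using parent_edge edge_in_V by blast

lemma funpow_parent_in_V: "x \<in> V \<Longrightarrow> (par ^^ n) x \<in> V"
  by (induction n) (auto intro: parent_in_V)

lemma level_funpow_parent: "x \<in> V \<Longrightarrow> lev ((par ^^ n) x) = lev x + int n"
  by (induction n) (auto simp: level_parent funpow_parent_in_V)

lemma ancestor_on_ray:
  assumes "x \<in> V" "height n x = lev x"
  shows "lies_above E \<omega> (ray n) x"
  using assms
proof (induction "gdist E x (ray n)" arbitrary: x)
  case 0
  then have "x = ray n" using gdist_eq_0 by simp
  then show ?case unfolding lies_above_def by (metis funpow_0)
next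
  case (Suc d)
  then have ne: "x \<noteq> ray n" by auto
  have "lies_above E \<omega> (ray n) (par x)"
    using Suc.hyps parent_towards_ray[OF Suc.prems ne] parent_in_V[OF Suc.prems(1)] by auto
  then show ?case unfolding lies_above_def by (metis funpow_Suc_right comp_apply)
qed

lemma common_ancestor_exists:
  assumes "x \<in> V" "z \<in> V"
  shows "\<exists>n. lies_above E \<omega> ((par ^^ n) x) z"
proof -
  obtain N where "\<And>n u. n \<ge> N \<Longrightarrow> u \<in> {x, z} \<Longrightarrow> height n u = lev u"
    using levels_attained_together[of "{x, z}"] assms by auto
  then have "lies_above E \<omega> (ray N) x" "lies_above E \<omega> (ray N) z"
    using ancestor_on_ray assms by simp_all
  moreover from this(1) obtain n where "ray N = (par ^^ n) x"
    unfolding lies_above_def by blast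
  ultimately show ?thesis by auto
qed

lemma succs_eq_children:
  assumes "x \<in> V" shows "succs E \<omega> x = {y \<in> V. par y = x}"
proof (intro equalityI subsetI)
  fix y assume "y \<in> succs E \<omega> x"
  then have y: "(x, y) \<in> E" "y \<noteq> par x" unfolding succs_def by auto
  then have "lev y = lev x - 1" using level_edge parent_unique by blast
  then show "y \<in> {y \<in> V. par y = x}"
    using parent_unique[of y x] y edge_sym edge_in_V by auto
next
  fix y assume y: "y \<in> {y \<in> V. par y = x}"
  then have "(x, y) \<in> E" using parent_edge edge_sym by blast
  moreover have "y \<noteq> par x"
    using y level_parent[of y] level_parent[OF assms] by auto
  ultimately show "y \<in> succs E \<omega> x" unfolding succs_def by simp
qed

lemma nth_succs_eq:
  assumes "x \<in> V" shows "nth_succs E \<omega> n x = {y \<in> V. (par ^^ n) y = x}"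
proof (induction n)
  case (Suc n)
  have "nth_succs E \<omega> (Suc n) x = (\<Union>y\<in>{y \<in> V. (par ^^ n) y = x}. {w \<in> V. par w = y})"
    using Suc succs_eq_children by simp
  also have "\<dots> = {w \<in> V. (par ^^ Suc n) w = x}"
    using parent_in_V by (auto simp: funpow_swap1)
  finally show ?case .
qed (use assms in auto)

lemma sector_iff:
  assumes "x \<in> V" shows "y \<in> sector E \<omega> x \<longleftrightarrow> y \<in> V \<and> lies_above E \<omega> x y"
  unfolding sector_def lies_above_def by (auto simp: nth_succs_eq[OF assms])

lemma lies_above_parent:
  assumes "lies_above E \<omega> u z" shows "lies_above E \<omega> (par u) z"
proof -
  obtain n where "u = (par ^^ n) z" using assms unfolding lies_above_def by blast
  then have "par u = (par ^^ Suc n) z" by simp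
  then show ?thesis unfolding lies_above_def by (rule exI)
qed

lemma lies_above_funpow_mono:
  assumes "lies_above E \<omega> ((par ^^ i) x) z" "i \<le> j"
  shows "lies_above E \<omega> ((par ^^ j) x) z"
  using assms(2,1) by (induction rule: dec_induct) (auto intro: lies_above_parent)

lemma lies_above_level:
  assumes "lies_above E \<omega> u z" "z \<in> V"
  shows "lev z \<le> lev u" "lev u = lev z \<Longrightarrow> u = z"
proof -
  obtain n where "u = (par ^^ n) z" using assms(1) unfolding lies_above_def by blast
  then show "lev z \<le> lev u" "lev u = lev z \<Longrightarrow> u = z"
    using level_funpow_parent[OF assms(2), of n] by auto
qed

text \<open>
  Only the child \<open>u\<close> of \<open>par u\<close> can have \<open>u\<close> in its sector, since distinct vertices of equal level do
  not lie above one another. The choice in \<open>Psi\<close> is therefore between \<open>u\<close> and no child at all.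
\<close>
lemma Psi_parent:
  assumes u: "u \<in> V" and z: "z \<in> V"
  shows "Psi E \<omega> m (par u) u z =
    (if lies_above E \<omega> u z then 1 / m u - 1 / m (par u)
     else if lies_above E \<omega> (par u) z \<and> z \<noteq> par u then - 1 / m (par u)
     else 0)"
proof -
  have p: "par u \<in> V" by (rule parent_in_V[OF u])
  have self: "lies_above E \<omega> u u" unfolding lies_above_def by (metis funpow_0)
  have "u \<noteq> par u" using level_parent[OF u] by auto
  then have u_in: "u \<in> punctured_sector E \<omega> (par u)"
    unfolding punctured_sector_def using sector_iff[OF p] u self lies_above_parent by auto
  have z_in: "z \<in> punctured_sector E \<omega> (par u) \<longleftrightarrow> lies_above E \<omega> (par u) z \<and> z \<noteq> par u"
    unfolding punctured_sector_def using sector_iff[OF p] z by auto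
  have only: "y \<in> succs E \<omega> (par u) \<and> {z, u} \<subseteq> sector E \<omega> y
      \<longleftrightarrow> y = u \<and> lies_above E \<omega> u z" for y
  proof
    assume y: "y \<in> succs E \<omega> (par u) \<and> {z, u} \<subseteq> sector E \<omega> y"
    then have yV: "y \<in> V" "par y = par u" using succs_eq_children[OF p] by auto
    then have "lev y = lev u" using level_parent[of y] level_parent[OF u] by simp
    moreover have "lies_above E \<omega> y u" "lies_above E \<omega> y z"
      using y sector_iff[OF yV(1)] by auto
    ultimately show "y = u \<and> lies_above E \<omega> u z" using lies_above_level(2)[OF _ u] by blast
  next
    assume "y = u \<and> lies_above E \<omega> u z"
    then show "y \<in> succs E \<omega> (par u) \<and> {z, u} \<subseteq> sector E \<omega> y"
      using u z self sector_iff[OF u] succs_eq_children[OF p] by simp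
  qed
  have "z \<noteq> par u" if "lies_above E \<omega> u z"
    using lies_above_level(1)[OF that z] level_parent[OF u] by auto
  then have above: "lies_above E \<omega> u z \<Longrightarrow> z \<in> punctured_sector E \<omega> (par u)"
    using z_in lies_above_parent by blast
  have ex: "(\<exists>y\<in>succs E \<omega> (par u). {z, u} \<subseteq> sector E \<omega> y) \<longleftrightarrow> lies_above E \<omega> u z"
    using only by blast
  have the: "lies_above E \<omega> u z \<Longrightarrow> (THE y. y \<in> succs E \<omega> (par u) \<and> {z, u} \<subseteq> sector E \<omega> y) = u"
    using only by simp
  show ?thesis
    unfolding Psi_def ex using the above u_in z_in by auto
qed

definition meet_index :: "'v \<Rightarrow> 'v \<Rightarrow> nat" where
  "meet_index x z = (LEAST n. lies_above E \<omega> ((par ^^ n) x) z)"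

lemma lies_above_iff_meet_index:
  assumes "x \<in> V" "z \<in> V"
  shows "lies_above E \<omega> ((par ^^ n) x) z \<longleftrightarrow> meet_index x z \<le> n"
  unfolding meet_index_def
  using LeastI_ex[OF common_ancestor_exists[OF assms]] Least_le lies_above_funpow_mono by metis

lemma confluent_eq:
  assumes x: "x \<in> V" and z: "z \<in> V"
  shows "confluent E \<omega> x z = (par ^^ meet_index x z) x"
  unfolding confluent_def
proof (rule the_equality)
  let ?j = "meet_index x z"
  let ?P = "\<lambda>u. lies_above E \<omega> u x \<and> lies_above E \<omega> u z"
  have common: "?P u \<longleftrightarrow> (\<exists>n\<ge>?j. u = (par ^^ n) x)" for u
    using lies_above_iff_meet_index[OF x z] unfolding lies_above_def[of _ _ u x] by auto
  have least: "lev ((par ^^ ?j) x) \<le> lev u" if "?P u" for u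
    using that common level_funpow_parent[OF x] by auto
  have P_j: "?P ((par ^^ ?j) x)" unfolding common by blast
  show "is_arg_min lev ?P ((par ^^ ?j) x)"
    unfolding is_arg_min_def using P_j least by (auto simp: not_less)
  fix v assume v: "is_arg_min lev ?P v"
  then have "?P v" unfolding is_arg_min_def by (rule conjunct1)
  then obtain n where n: "n \<ge> ?j" "v = (par ^^ n) x" unfolding common by blast
  have "\<not> lev ((par ^^ ?j) x) < lev v"
    using v P_j unfolding is_arg_min_def by blast
  with n show "v = (par ^^ ?j) x" using level_funpow_parent[OF x] by auto
qed

end


section \<open>Summation along the ancestors of a vertex\<close>

text \<open>
  The upper bound comes from replacing all weights by \<open>1\<close>, the lower bound from keeping only the
  first term.
\<close>
lemma damped_telescoping_sum:
  fixes a w :: "nat \<Rightarrow> real"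
  assumes dec: "\<And>n. a (Suc n) \<le> a n" and nonneg: "\<And>n. 0 \<le> a n"
    and w: "\<And>n. 0 \<le> w n" "\<And>n. w n \<le> 1" "w 0 = 1"
  defines "b \<equiv> \<lambda>n. w n * (a n - a (Suc n))"
  shows "summable b" "a 0 - a 1 \<le> suminf b" "suminf b \<le> a 0"
proof -
  have b0: "0 \<le> b n" for n unfolding b_def using dec w by simp
  have bound: "sum b {..<N} \<le> a 0" for N
  proof -
    have "sum b {..<N} \<le> (\<Sum>n<N. a n - a (Suc n))"
      unfolding b_def using dec w by (intro sum_mono mult_left_le_one_le) auto
    also have "\<dots> = a 0 - a N" by (rule sum_lessThan_telescope')
    finally show ?thesis using nonneg[of N] by simp
  qed
  show s: "summable b" using summableI_nonneg_bounded[of b "a 0"] b0 bound by simp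
  show "suminf b \<le> a 0" using suminf_le_const[OF s] bound by simp
  show "a 0 - a 1 \<le> suminf b"
    using sum_le_suminf[OF s, of "{0}"] b0 w(3) unfolding b_def by simp
qed

lemma geometric_tail_sums:
  fixes k :: real assumes "1 < k"
  shows "(\<lambda>i. k powi (N - int i)) sums (k powi N * (k / (k - 1)))"
proof -
  have "(\<lambda>i. (1 / k) ^ i) sums (1 / (1 - 1 / k))"
    using assms by (intro geometric_sums) simp
  moreover have "1 / (1 - 1 / k) = k / (k - 1)" using assms by (simp add: field_simps)
  ultimately have "(\<lambda>i. k powi N * (1 / k) ^ i) sums (k powi N * (k / (k - 1)))"
    using sums_mult by metis
  moreover have "k powi N * (1 / k) ^ i = k powi (N - int i)" for i
    using assms by (simp add: power_int_diff power_divide)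
  ultimately show ?thesis by simp
qed

locale tree_flow = tree_end V E v0 \<omega> for V :: "'v set" and E v0 \<omega> +
  fixes m :: "'v \<Rightarrow> real" and k C :: real
  assumes two_successors: "x \<in> V \<Longrightarrow> 2 \<le> card (succs E \<omega> x)"
    and flow: "flow_measure V E \<omega> m"
    and parent_mass_le: "x \<in> V \<Longrightarrow> m (par x) \<le> C * m x"
    and C_pos: "0 < C"
    and k_gt_1: "1 < k"
begin

lemma m_pos: "x \<in> V \<Longrightarrow> 0 < m x"
  using flow unfolding flow_measure_def by blast

text \<open>
  The vertex \<open>x\<close> has a sibling, to which the bound \<open>C\<close> on the ratio of masses applies as well.
\<close>
lemma mass_growth:
  assumes x: "x \<in> V"
  shows "m x + m (par x) / C \<le> m (par x)"
proof -
  have p: "par x \<in> V" using x by (rule parent_in_V)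
  have c: "2 \<le> card (succs E \<omega> (par x))" by (rule two_successors[OF p])
  then have fin: "finite (succs E \<omega> (par x))" by (metis card.infinite not_numeral_le_zero)
  have "\<not> succs E \<omega> (par x) \<subseteq> {x}"
  proof
    assume "succs E \<omega> (par x) \<subseteq> {x}"
    then have "card (succs E \<omega> (par x)) \<le> card {x}" by (intro card_mono) auto
    with c show False by simp
  qed
  then obtain y where y: "y \<in> succs E \<omega> (par x)" "y \<noteq> x" by blast
  then have yV: "y \<in> V" "par y = par x" using succs_eq_children[OF p] by auto
  have "m x + m y = (\<Sum>u\<in>{x, y}. m u)" using y by simp
  also have "\<dots> \<le> (\<Sum>u\<in>succs E \<omega> (par x). m u)"
    using fin y x succs_eq_children[OF p] m_pos
    by (intro sum_mono2) (auto intro: less_imp_le)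
  also have "\<dots> = m (par x)" using flow p unfolding flow_measure_def by simp
  finally have "m x + m y \<le> m (par x)" .
  moreover have "m (par x) / C \<le> m y"
    using parent_mass_le[OF yV(1)] yV(2) C_pos by (simp add: field_simps)
  ultimately show ?thesis by linarith
qed

lemma inverse_mass_drop:
  assumes x: "x \<in> V"
  shows "1 / (C * m x) \<le> 1 / m x - 1 / m (par x)" 
proof -
  have pos: "0 < m x" "0 < m (par x)" using x parent_in_V m_pos by auto
  show ?thesis using mass_growth[OF x] pos C_pos by (simp add: field_simps)
qed

lemma S_sum_eq:
  "S_sum E \<omega> (\<lambda>n. k powi n) N x = k powi (lev x + N) * (k / (k - 1))"
  unfolding S_sum_def using geometric_tail_sums[OF k_gt_1, of "lev x + N"] by (rule sums_unique[symmetric])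

text \<open>
  Here \<open>s\<close> is the sum of the terms from the confluent on, rescaled so that the weights are
  \<open>k\<^sup>-\<^sup>i\<close>. The subtracted term comes from the child of \<open>w\<close> above \<open>x\<close> when \<open>z\<close> lies strictly below
  another child; its weight is larger by the factor \<open>k\<close> since that child is one level lower.
\<close>
lemma bergman_kernel_eq:
  assumes x: "x \<in> V" and z: "z \<in> V"
  defines "w \<equiv> confluent E \<omega> x z"
  obtains s where "1 / (C * m w) \<le> s" "s \<le> 1 / m w"
    "bergman_kernel E \<omega> m (\<lambda>n. k powi n) x z =
       (1 - 1 / k) / k powi lev w * (s - (if w = x \<or> w = z then 0 else k / m w))"
proof -
  define j where "j = meet_index x z"
  define q where "q n = (par ^^ n) x" for n
  define t where "t n = Psi E \<omega> m (q (n + 1)) (q n) z / S_sum E \<omega> (\<lambda>n. k powi n) (int n) x" for n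
  define B where "B = (1 - 1 / k) / k powi lev w"
  define a where "a n = 1 / m (q (n + j))" for n
  define b where "b n = (1 / k) ^ n * (a n - a (Suc n))" for n
  have wj: "w = q j" unfolding w_def q_def j_def by (rule confluent_eq[OF x z])
  have levw: "lev w = lev x + int j" unfolding wj q_def by (rule level_funpow_parent[OF x])
  have qV: "q n \<in> V" and q_Suc: "q (Suc n) = par (q n)" for n
    unfolding q_def using funpow_parent_in_V[OF x] by auto
  have above: "lies_above E \<omega> (q n) z \<longleftrightarrow> j \<le> n" for n
    unfolding q_def j_def by (rule lies_above_iff_meet_index[OF x z])
  have t_eq: "t n = Psi E \<omega> m (par (q n)) (q n) z * (1 - 1 / k) / k powi (lev x + int n)" for n
    unfolding t_def S_sum_eq using q_Suc k_gt_1 by (simp add: field_simps)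
  have Psi_eq: "Psi E \<omega> m (par (q n)) (q n) z =
      (if j \<le> n then 1 / m (q n) - 1 / m (q (Suc n))
       else if j \<le> Suc n \<and> z \<noteq> q (Suc n) then - 1 / m (q (Suc n)) else 0)" for n
    using Psi_parent[OF qV z, of m n] above[of n] above[of "Suc n"] q_Suc by simp
  have tail: "t (n + j) = B * b n" for n
  proof -
    have "k powi (lev x + int (n + j)) = k powi lev w * k ^ n"
      unfolding levw using k_gt_1 by (simp add: power_int_add flip: power_int_of_nat)
    then show ?thesis
      unfolding t_eq Psi_eq b_def a_def B_def by (simp add: power_divide)
  qed
  \<comment> \<open>Strictly below the confluent only the last ancestor of \<open>x\<close> can contribute.\<close>
  have head: "(\<Sum>n<j. t n) = - B * (if w = x \<or> w = z then 0 else k / m w)"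
  proof (cases j)
    case 0
    then show ?thesis using wj unfolding q_def by simp
  next
    case (Suc i)
    have "lev w \<noteq> lev x" using levw Suc by simp
    then have "w \<noteq> x" by blast
    have "t n = 0" if "n < i" for n unfolding t_eq Psi_eq using Suc that by simp
    then have "(\<Sum>n<j. t n) = t i" using Suc by simp
    also have "\<dots> = - B * (if w = x \<or> w = z then 0 else k / m w)"
    proof -
      have "k powi lev w = k powi (lev x + int i) * k"
        unfolding levw Suc using k_gt_1 by (simp add: power_int_add)
      then show ?thesis
        unfolding t_eq Psi_eq B_def using Suc \<open>w \<noteq> x\<close> wj k_gt_1 by auto
    qed
    finally show ?thesis .
  qed
  have drop: "1 / (C * m (q n)) \<le> 1 / m (q n) - 1 / m (q (Suc n))" for n
    using inverse_mass_drop[OF qV] q_Suc by simp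
  have pos: "0 < 1 / (C * m (q n))" for n using C_pos m_pos[OF qV] by simp
  have dec: "a (Suc n) \<le> a n" for n
    using drop[of "n + j"] pos[of "n + j"] unfolding a_def add_Suc by linarith
  have nonneg: "0 \<le> a n" for n
    unfolding a_def using m_pos[OF qV] by (simp add: less_imp_le)
  have ineqs: "summable b" "a 0 - a 1 \<le> suminf b" "suminf b \<le> a 0"
    unfolding b_def
    using damped_telescoping_sum[where a = a and w = "\<lambda>n. (1 / k) ^ n"] dec nonneg k_gt_1
    by (simp_all add: power_le_one)
  have "(\<lambda>n. t (n + j)) sums (B * suminf b)"
    unfolding tail by (intro sums_mult summable_sums ineqs)
  then have "t sums (B * suminf b + (\<Sum>n<j. t n))" by (simp add: sums_iff_shift)
  then have "bergman_kernel E \<omega> m (\<lambda>n. k powi n) x z = B * suminf b + (\<Sum>n<j. t n)"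
    unfolding bergman_kernel_def t_def q_def using sums_unique by fastforce
  also have "\<dots> = B * (suminf b - (if w = x \<or> w = z then 0 else k / m w))"
    unfolding head by (simp add: right_diff_distrib)
  finally show ?thesis
    using that[of "suminf b"] ineqs drop[of j] unfolding B_def a_def wj by simp
qed

text \<open>
  The case without the subtracted term is the reason for the constant \<open>1 / C\<close>; with it, the kernel is
  negative, and \<open>k - 1\<close> is what remains of \<open>k\<close> after the tail, at most \<open>1 / m w\<close>, has been added.
\<close>
lemma bergman_kernel_comparable:
  assumes "x \<in> V" "z \<in> V"
  defines "w \<equiv> confluent E \<omega> x z"
  defines "K \<equiv> bergman_kernel E \<omega> m (\<lambda>n. k powi n) x z"
    and "R \<equiv> 1 / (k powi lev w * m w)"
  shows "\<bar>K\<bar> \<le> k * R" "(1 - 1 / k) * min (1 / C) (k - 1) * R \<le> \<bar>K\<bar>"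
proof -
  obtain s where s: "1 / (C * m w) \<le> s" "s \<le> 1 / m w"
    and K: "K = (1 - 1 / k) / k powi lev w * (s - (if w = x \<or> w = z then 0 else k / m w))"
    using bergman_kernel_eq[OF assms(1,2)] unfolding w_def K_def by metis
  have mw: "0 < m w"
    unfolding w_def confluent_eq[OF assms(1,2)] using m_pos funpow_parent_in_V assms(1) by blast
  let ?t = "s - (if w = x \<or> w = z then 0 else k / m w)"
  have c: "0 < 1 - 1 / k" "1 - 1 / k \<le> 1" "0 < k powi lev w" using k_gt_1 by auto
  have "min (1 / C) (k - 1) * (1 / m w) \<le> \<bar>?t\<bar> \<and> \<bar>?t\<bar> \<le> k * (1 / m w)"
  proof (cases "w = x \<or> w = z")
    case True
    have "min (1 / C) (k - 1) * (1 / m w) \<le> 1 / C * (1 / m w)"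
      using mw by (intro mult_right_mono) auto
    moreover have "0 < s" using C_pos mw by (intro less_le_trans[OF _ s(1)]) simp
    moreover have "1 / m w \<le> k * (1 / m w)" using k_gt_1 mw by (simp add: field_simps)
    ultimately show ?thesis using True s by auto
  next
    case False
    have "min (1 / C) (k - 1) * (1 / m w) \<le> (k - 1) * (1 / m w)"
      using mw by (intro mult_right_mono) auto
    moreover have "0 < s" using C_pos mw by (intro less_le_trans[OF _ s(1)]) simp
    moreover have "(k - 1) * (1 / m w) = k / m w - 1 / m w" by (simp add: diff_divide_distrib)
    moreover have "0 < (k - 1) * (1 / m w)" using k_gt_1 mw by simp
    ultimately show ?thesis using False s by auto
  qed
  then have lo: "min (1 / C) (k - 1) * (1 / m w) \<le> \<bar>?t\<bar>" and up: "\<bar>?t\<bar> \<le> k * (1 / m w)" by auto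
  have absK: "\<bar>K\<bar> = (1 - 1 / k) / k powi lev w * \<bar>?t\<bar>"
    unfolding K abs_mult using c by simp
  have "\<bar>K\<bar> \<le> 1 / k powi lev w * (k * (1 / m w))"
    unfolding absK using up c by (intro mult_mono divide_right_mono) auto
  then show "\<bar>K\<bar> \<le> k * R" unfolding R_def by (simp add: field_simps)
  have "(1 - 1 / k) / k powi lev w * (min (1 / C) (k - 1) * (1 / m w)) \<le> \<bar>K\<bar>"
    unfolding absK using lo c by (intro mult_left_mono) auto
  then show "(1 - 1 / k) * min (1 / C) (k - 1) * R \<le> \<bar>K\<bar>"
    unfolding R_def by (simp add: ac_simps)
qed

end


section \<open>The kernel estimate\<close>

theorem proposition3p3:
  fixes V :: "'v set" and E :: "'v rel" and v0 :: 'v and \<omega> :: "(nat \<Rightarrow> 'v) set"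
    and m :: "'v \<Rightarrow> real" and \<sigma>\<^sub>c :: "int \<Rightarrow> real" and k\<^sub>c :: real
  assumes tree: "is_tree V E" "infinite V" "locally_finite V E"
    and root: "v0 \<in> V" "\<omega> \<in> boundary V E v0"
    and two_succs: "\<And>x. x \<in> V \<Longrightarrow> 2 \<le> card (succs E \<omega> x)"
    and flow: "flow_measure V E \<omega> m"
    and C_m_finite: "bdd_above ((\<lambda>x. m (parent E \<omega> x) / m x) ` V)"
    and k_c: "1 < k\<^sub>c"
    and sigma: "\<And>n. \<sigma>\<^sub>c n = k\<^sub>c powi n"
  shows "\<exists>C>0. \<forall>x\<in>V. \<forall>z\<in>V.
     \<bar>bergman_kernel E \<omega> m \<sigma>\<^sub>c x z\<bar>
       \<le> C * (1 / (\<sigma>\<^sub>c (level E \<omega> (confluent E \<omega> x z)) * m (confluent E \<omega> x z))) \<and>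
     1 / (\<sigma>\<^sub>c (level E \<omega> (confluent E \<omega> x z)) * m (confluent E \<omega> x z))
       \<le> C * \<bar>bergman_kernel E \<omega> m \<sigma>\<^sub>c x z\<bar>"
proof -
  obtain C0 where C0: "\<And>x. x \<in> V \<Longrightarrow> m (parent E \<omega> x) / m x \<le> C0"
    using C_m_finite unfolding bdd_above_def by auto
  define C where "C = max C0 1"
  have C: "0 < C" unfolding C_def by simp
  have mass: "m (parent E \<omega> x) \<le> C * m x" if "x \<in> V" for x
  proof -
    have "0 < m x" using flow that unfolding flow_measure_def by blast
    moreover have "m (parent E \<omega> x) / m x \<le> C" using C0[OF that] unfolding C_def by simp
    ultimately show ?thesis by (simp add: pos_divide_le_eq)
  qed
  interpret tree_flow V E v0 \<omega> m k\<^sub>c C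
    by unfold_locales (use tree root two_succs flow mass C k_c in auto)
  have \<sigma>: "\<sigma>\<^sub>c = (\<lambda>n. k\<^sub>c powi n)" using sigma by auto
  define \<epsilon> where "\<epsilon> = (1 - 1 / k\<^sub>c) * min (1 / C) (k\<^sub>c - 1)"
  have \<epsilon>: "0 < \<epsilon>" unfolding \<epsilon>_def using k_c C by simp
  show ?thesis
  proof (intro exI[of _ "max k\<^sub>c (1 / \<epsilon>)"] conjI ballI)
    show "0 < max k\<^sub>c (1 / \<epsilon>)" using k_c by simp
    fix x z assume xz: "x \<in> V" "z \<in> V"
    let ?w = "confluent E \<omega> x z" and ?K = "bergman_kernel E \<omega> m \<sigma>\<^sub>c x z"
    let ?R = "1 / (\<sigma>\<^sub>c (level E \<omega> ?w) * m ?w)"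
    have bounds: "\<bar>?K\<bar> \<le> k\<^sub>c * ?R" "\<epsilon> * ?R \<le> \<bar>?K\<bar>"
      unfolding \<sigma> \<epsilon>_def using bergman_kernel_comparable[OF xz] by auto
    have "0 < m ?w"
      unfolding confluent_eq[OF xz] using m_pos funpow_parent_in_V xz(1) by blast
    then have R: "0 \<le> ?R" unfolding \<sigma> using k_c by simp
    show "\<bar>?K\<bar> \<le> max k\<^sub>c (1 / \<epsilon>) * ?R"
      using bounds(1) mult_right_mono[OF max.cobounded1 R] by (rule order_trans)
    have "?R \<le> 1 / \<epsilon> * \<bar>?K\<bar>" using bounds(2) \<epsilon> by (simp add: field_simps)
    then show "?R \<le> max k\<^sub>c (1 / \<epsilon>) * \<bar>?K\<bar>"
      using mult_right_mono[OF max.cobounded2 abs_ge_zero] by (rule order_trans)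
  qed
qed

end
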